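(* Let $\Gamma$ be a finitely generated group, let $\Gamma\curvearrowright X$ be a WEDS and let $\Gamma\curvearrowright Y$ be a zero-dimensional topological factor of $\Gamma\curvearrowright X$. Then $\Gamma\curvearrowright Y$ is a WEDS.
   Context: All actions are by homeomorphisms on compact metrizable spaces; zero-dimensional means compact, metrizable and of topological dimension zero. A topological factor of $\Gamma\curvearrowright X$ is an action $\Gamma\curvearrowright Y$ for which there is a continuous surjective $\Gamma$-equivariant map $X\to Y$. Effective subshifts. For a finite alphabet $A$, $\Gamma$ acts on $A^\Gamma$ (prodiscrete topology) by $(gx)(h)=x(g^{-1}h)$; a $\Gamma$-subshift is a closed $\Gamma$-invariant subset. Let $S$ be a finite generating set of $\Gamma$, $F(S)$ the free group on $S$, $\phi\colon F(S)\to\Gamma$ the canonical epimorphism. The pullback of a subshift $X\subset A^\Gamma$ is $\widehat X=\{x\circ\phi:x\in X\}\subset A^{F(S)}$. $X$ is effective if for some (equivalently any) finite generating set $S$ the set $\widehat X$ is effectively closed in $A^{F(S)}$, i.e. the set of patterns $p\colon W\to A$, $W\subset F(S)$ finite, such that no $y\in\widehat X$ satisfies $y|_W=p$ is recursively enumerable. WEDS. An action $\Gamma\curvearrowright X$ on a zero-dimensional space is a weak effective dynamical system (WEDS) if for every clopen partition $\mathcal P=(P_i)_{i=1}^n$ of $X$ the subshift $$Y(\Gamma\curvearrowright X,\mathcal P)=\{y\in\{1,\dots,n\}^\Gamma:\text{there is }x\in X\text{ such that }g^{-1}x\in P_{y(g)}\text{ for every }g\in\Gamma\}$$ is effectiv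e. *)

theory Defs
  imports
    "HOL-Algebra.Group_Action"
    "HOL-Algebra.Generated_Groups"
    "HOL-Analysis.Analysis"
    "HOL-Library.Nat_Bijection"
begin

section \<open>Recursively enumerable sets\<close>

text \<open>Programs for the partial recursive functions.  Arities are not recorded: the result of a
  program on an argument tuple is given by the relation \<open>computes\<close>, and a program simply has no
  result on tuples of unsuitable length.\<close>

datatype recf =
    Zero
  | Succ
  | Proj nat
  | Comp recf "recf list"
  | PrimRec recf recf
  | Mu recf

inductive computes :: "recf \<Rightarrow> nat list \<Rightarrow> nat \<Rightarrow> bool" where
  Zero: "computes Zero xs 0"
| Succ: "computes Succ [x] (Suc x)"
| Proj: "i < length xs \<Longrightarrow> computes (Proj i) xs (xs ! i)"
| Comp: "list_all2 (\<lambda>g y. computes g xs y) gs ys \<Longrightarrow> computes f ys z \<Longrightarrow> computes (Comp f gs) xs z"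
| PrimRec_0: "computes f xs y \<Longrightarrow> computes (PrimRec f g) (0 # xs) y"
| PrimRec_Suc: "computes (PrimRec f g) (n # xs) r \<Longrightarrow> computes g (n # r # xs) y \<Longrightarrow>
    computes (PrimRec f g) (Suc n # xs) y"
| Mu: "computes f (n # xs) 0 \<Longrightarrow> (\<forall>m<n. \<exists>k. computes f (m # xs) (Suc k)) \<Longrightarrow> computes (Mu f) xs n"

inductive_cases computes_ZeroE: "computes Zero xs y"
inductive_cases computes_SuccE: "computes Succ xs y"
inductive_cases computes_ProjE: "computes (Proj i) xs y"
inductive_cases computes_CompE: "computes (Comp f gs) xs y"
inductive_cases computes_PrimRec_0E: "computes (PrimRec f g) (0 # xs) y"
inductive_cases computes_PrimRec_SucE: "computes (PrimRec f g) (Suc n # xs) y"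
inductive_cases computes_MuE: "computes (Mu f) xs y"

lemma computes_deterministic:
  assumes "computes f xs y" "computes f xs z"
  shows "y = z"
  using assms
proof (induction arbitrary: z rule: computes.induct)
  case (Comp xs gs ys f w)
  from Comp.prems obtain ys' where ys': "list_all2 (\<lambda>g y. computes g xs y) gs ys'" "computes f ys' z"
    by (blast elim: computes_CompE)
  have "ys = ys'"
    using Comp.IH(1) ys'(1) by (auto simp: list_all2_conv_all_nth intro!: nth_equalityI)
  then show ?case using Comp.IH ys' by blast
next
  case (PrimRec_Suc f g n xs r y)
  from PrimRec_Suc.prems obtain r' where "computes (PrimRec f g) (n # xs) r'" "computes g (n # r' # xs) z"
    by (blast elim: computes_PrimRec_SucE)
  then show ?case using PrimRec_Suc.IH by blast
next
  case (Mu f n xs)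
  have z: "computes f (z # xs) 0" "\<forall>m<z. \<exists>k. computes f (m # xs) (Suc k)"
    by (rule computes_MuE[OF Mu.prems], assumption)+
  show ?case
  proof (rule linorder_cases[of n z])
    assume "n < z"
    then obtain k where "computes f (n # xs) (Suc k)" using z by blast
    then show ?thesis using Mu.IH(1) by fastforce
  next
    assume "z < n"
    then obtain k where "\<And>w. computes f (z # xs) w \<Longrightarrow> Suc k = w" using Mu.IH(2) by blast
    then show ?thesis using z by fastforce
  qed
qed (blast elim: computes_ZeroE computes_SuccE computes_ProjE computes_PrimRec_0E)+

definition recursively_enumerable :: "nat set \<Rightarrow> bool" where
  "recursively_enumerable A \<longleftrightarrow> (\<exists>f. A = {n. \<exists>y. computes f [n] y})"


section \<open>Finitely generated groups and free groups\<close>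

definition finitely_generated :: "('g, 'm) monoid_scheme \<Rightarrow> bool" where
  "finitely_generated G \<longleftrightarrow> (\<exists>S. finite S \<and> S \<subseteq> carrier G \<and> generate G S = carrier G)"

text \<open>A letter \<open>(s, True)\<close> stands for the generator \<open>s\<close> and \<open>(s, False)\<close> for its formal
  inverse.  The elements of the free group are the reduced words.\<close>

type_synonym 'g word = "('g \<times> bool) list"

definition inv_letter :: "'g \<times> bool \<Rightarrow> 'g \<times> bool" where
  "inv_letter l = (fst l, \<not> snd l)"

definition reduced_word :: "'g word \<Rightarrow> bool" where
  "reduced_word w \<longleftrightarrow> (\<forall>i. Suc i < length w \<longrightarrow> w ! Suc i \<noteq> inv_letter (w ! i))"

fun cancel_Cons :: "'g \<times> bool \<Rightarrow> 'g word \<Rightarrow> 'g word" where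
  "cancel_Cons l [] = [l]"
| "cancel_Cons l (k # w) = (if k = inv_letter l then w else l # k # w)"

definition free_group :: "'g set \<Rightarrow> 'g word monoid" where
  "free_group S = \<lparr>carrier = {w. reduced_word w \<and> fst ` set w \<subseteq> S},
     monoid.mult = (\<lambda>u v. foldr cancel_Cons u v), one = []\<rparr>"

definition eval_letter :: "('g, 'm) monoid_scheme \<Rightarrow> 'g \<times> bool \<Rightarrow> 'g" where
  "eval_letter G l = (if snd l then fst l else inv\<^bsub>G\<^esub> (fst l))"

text \<open>The canonical homomorphism from the free group on a subset of \<open>G\<close> to \<open>G\<close>.\<close>

definition eval_word :: "('g, 'm) monoid_scheme \<Rightarrow> 'g word \<Rightarrow> 'g" where
  "eval_word G w = foldr (\<lambda>l g. eval_letter G l \<otimes>\<^bsub>G\<^esub> g) w \<one>\<^bsub>G\<^esub>"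

lemma inv_letter_inv_letter [simp]: "inv_letter (inv_letter l) = l"
  by (simp add: inv_letter_def)

lemma fst_inv_letter [simp]: "fst (inv_letter l) = fst l"
  by (simp add: inv_letter_def)

lemma reduced_Nil [simp]: "reduced_word []"
  by (simp add: reduced_word_def)

lemma reduced_Cons: "reduced_word (l # w) \<longleftrightarrow> reduced_word w \<and> (w \<noteq> [] \<longrightarrow> hd w \<noteq> inv_letter l)"
  by (cases w) (auto simp: reduced_word_def nth_Cons split: nat.splits)

lemma reduced_cancel_Cons: "reduced_word w \<Longrightarrow> reduced_word (cancel_Cons l w)"
  by (cases w) (auto simp: reduced_Cons)

lemma reduced_foldr: "reduced_word w \<Longrightarrow> reduced_word (foldr cancel_Cons u w)"
  by (induction u) (auto intro: reduced_cancel_Cons)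

lemma letters_cancel_Cons: "fst ` set (cancel_Cons l w) \<subseteq> insert (fst l) (fst ` set w)"
  by (cases w) auto

lemma letters_foldr: "fst ` set (foldr cancel_Cons u w) \<subseteq> fst ` set u \<union> fst ` set w"
proof (induction u)
  case (Cons l u)
  have "fst ` set (foldr cancel_Cons (l # u) w) \<subseteq> insert (fst l) (fst ` set (foldr cancel_Cons u w))"
    using letters_cancel_Cons by simp
  also have "\<dots> \<subseteq> insert (fst l) (fst ` set u \<union> fst ` set w)"
    using Cons.IH by (rule insert_mono)
  finally show ?case by simp
qed simp

lemma cancel_Cons_inverse: "reduced_word w \<Longrightarrow> cancel_Cons l (cancel_Cons (inv_letter l) w) = w"
  by (cases w; cases "tl w") (auto simp: reduced_Cons)

lemma foldr_cancel_Cons: "reduced_word w \<Longrightarrow>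
    foldr cancel_Cons (cancel_Cons l v) w = cancel_Cons l (foldr cancel_Cons v w)"
  by (cases v) (auto simp: cancel_Cons_inverse reduced_foldr)

lemma foldr_cancel_Cons_assoc: "reduced_word w \<Longrightarrow>
    foldr cancel_Cons (foldr cancel_Cons u v) w = foldr cancel_Cons u (foldr cancel_Cons v w)"
  by (induction u) (auto simp: foldr_cancel_Cons)

lemma foldr_cancel_Cons_Nil: "reduced_word w \<Longrightarrow> foldr cancel_Cons w [] = w"
proof (induction w)
  case (Cons l w)
  then show ?case by (cases w) (auto simp: reduced_Cons)
qed simp

lemma foldr_cancel_Cons_left_inv: "foldr cancel_Cons (rev (map inv_letter w)) w = []"
  by (induction w) auto

lemma reduced_inverse_word: "reduced_word w \<Longrightarrow> reduced_word (rev (map inv_letter w))"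
  unfolding reduced_word_def
proof (intro allI impI)
  fix i
  assume w: "\<forall>i. Suc i < length w \<longrightarrow> w ! Suc i \<noteq> inv_letter (w ! i)"
    and i: "Suc i < length (rev (map inv_letter w))"
  have "w ! Suc (length w - Suc (Suc i)) \<noteq> inv_letter (w ! (length w - Suc (Suc i)))"
    using w i by simp
  moreover have "Suc (length w - Suc (Suc i)) = length w - Suc i" using i by simp
  ultimately show "rev (map inv_letter w) ! Suc i \<noteq> inv_letter (rev (map inv_letter w) ! i)"
    using i by (simp add: rev_nth)
qed

lemma group_free_group: "group (free_group S)"
proof (rule groupI)
  fix x assume x: "x \<in> carrier (free_group S)"
  show "\<exists>y\<in>carrier (free_group S). y \<otimes>\<^bsub>free_group S\<^esub> x = \<one>\<^bsub>free_group S\<^esub>"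
  proof
    show "rev (map inv_letter x) \<otimes>\<^bsub>free_group S\<^esub> x = \<one>\<^bsub>free_group S\<^esub>"
      by (simp add: free_group_def foldr_cancel_Cons_left_inv)
    show "rev (map inv_letter x) \<in> carrier (free_group S)"
      using x by (auto simp: free_group_def reduced_inverse_word)
  qed
next
  fix x y assume "x \<in> carrier (free_group S)" "y \<in> carrier (free_group S)"
  then show "x \<otimes>\<^bsub>free_group S\<^esub> y \<in> carrier (free_group S)"
    using subset_trans[OF letters_foldr[of x y], of S] by (simp add: free_group_def reduced_foldr)
qed (auto simp: free_group_def foldr_cancel_Cons_assoc)

context group
begin

lemma eval_letter_closed: "fst l \<in> carrier G \<Longrightarrow> eval_letter G l \<in> carrier G"
  by (simp add: eval_letter_def)

lemma eval_word_Cons: "eval_word G (l # w) = eval_letter G l \<otimes> eval_word G w"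
  by (simp add: eval_word_def)

lemma eval_word_closed: "fst ` set w \<subseteq> carrier G \<Longrightarrow> eval_word G w \<in> carrier G"
  by (induction w) (auto simp: eval_word_def eval_letter_def)

lemma eval_word_cancel_Cons:
  assumes "fst l \<in> carrier G" "fst ` set w \<subseteq> carrier G"
  shows "eval_word G (cancel_Cons l w) = eval_letter G l \<otimes> eval_word G w"
proof (cases w)
  case (Cons k v)
  have "eval_letter G l \<otimes> (eval_letter G (inv_letter l) \<otimes> eval_word G v) = eval_word G v"
    using assms eval_word_closed[of v] Cons
    by (auto simp: eval_letter_def inv_letter_def m_assoc[symmetric])
  then show ?thesis using Cons by (auto simp: eval_word_Cons)
qed (simp add: eval_word_def)

lemma eval_word_hom:
  assumes "S \<subseteq> carrier G"
  shows "eval_word G \<in> hom (free_group S) G"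
proof (rule homI)
  fix u v assume uv: "u \<in> carrier (free_group S)" "v \<in> carrier (free_group S)"
  then have "fst ` set u \<subseteq> carrier G" "fst ` set v \<subseteq> carrier G"
    using assms by (auto simp: free_group_def)
  then have "eval_word G (foldr cancel_Cons u v) = eval_word G u \<otimes> eval_word G v"
  proof (induction u)
    case Nil
    then show ?case by (simp add: eval_word_closed) (simp add: eval_word_def eval_word_closed[unfolded eval_word_def])
  next
    case (Cons l u)
    moreover have "fst ` set (foldr cancel_Cons u v) \<subseteq> carrier G"
      using Cons.prems by (intro subset_trans[OF letters_foldr]) auto
    ultimately show ?case
      by (simp add: eval_word_cancel_Cons eval_word_Cons m_assoc eval_letter_closed eval_word_closed)
  qed
  then show "eval_word G (u \<otimes>\<^bsub>free_group S\<^esub> v) = eval_word G u \<otimes> eval_word G v"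
    by (simp add: free_group_def)
qed (use assms in \<open>auto simp: free_group_def intro!: eval_word_closed\<close>)

lemma eval_word_surj:
  assumes "S \<subseteq> carrier G"
  shows "eval_word G ` carrier (free_group S) = generate G S"
proof -
  interpret h: group_hom "free_group S" G "eval_word G"
    using eval_word_hom[OF assms] group_free_group
    by (auto simp: group_hom_def group_hom_axioms_def is_group)
  have lettersin: "[(s, b)] \<in> carrier (free_group S)" if "s \<in> S" for s b
    using that by (simp add: free_group_def reduced_Cons)
  have "s \<in> eval_word G ` carrier (free_group S)" if "s \<in> S" for s
    using lettersin[OF that, of True] that assms
    by (auto simp: eval_word_def eval_letter_def intro!: rev_image_eqI)
  then have "generate G S \<subseteq> eval_word G ` carrier (free_group S)"
    by (intro generate_subgroup_incl h.img_is_subgroup) auto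
  moreover have "eval_word G w \<in> generate G S" if "fst ` set w \<subseteq> S" for w
    using that
  proof (induction w)
    case Nil
    then show ?case by (simp add: eval_word_def generate.one)
  next
    case (Cons l w)
    then show ?case
      by (auto simp: eval_word_Cons eval_letter_def intro!: generate.eng intro: generate.incl generate.inv)
  qed
  ultimately show ?thesis by (auto simp: free_group_def)
qed

end


section \<open>Effective subshifts\<close>

text \<open>Configurations are extensional functions on the group, so that they are determined by their
  values on the carrier.\<close>

definition shift :: "('g, 'm) monoid_scheme \<Rightarrow> 'g \<Rightarrow> ('g \<Rightarrow> 'a) \<Rightarrow> 'g \<Rightarrow> 'a" where
  "shift G g x = (\<lambda>h\<in>carrier G. x (inv\<^bsub>G\<^esub> g \<otimes>\<^bsub>G\<^esub> h))"

definition subshift :: "('g, 'm) monoid_scheme \<Rightarrow> 'a set \<Rightarrow> ('g \<Rightarrow> 'a) set \<Rightarrow> bool" where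
  "subshift G A X \<longleftrightarrow> finite A \<and>
     closedin (product_topology (\<lambda>_. discrete_topology A) (carrier G)) X \<and>
     (\<forall>g\<in>carrier G. \<forall>x\<in>X. shift G g x \<in> X)"

definition pullback :: "('g, 'm) monoid_scheme \<Rightarrow> 'g set \<Rightarrow> ('g \<Rightarrow> 'a) set \<Rightarrow> ('g word \<Rightarrow> 'a) set" where
  "pullback G S X = (\<lambda>x. restrict (x \<circ> eval_word G) (carrier (free_group S))) ` X"

text \<open>A pattern with finite support \<open>W\<close> is a partial map with domain \<open>W\<close>.\<close>

definition forbidden_patterns :: "'w set \<Rightarrow> 'a set \<Rightarrow> ('w \<Rightarrow> 'a) set \<Rightarrow> ('w \<rightharpoonup> 'a) set" where
  "forbidden_patterns F A Z = {p. finite (dom p) \<and> dom p \<subseteq> F \<and> ran p \<subseteq> A \<and>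
     \<not> (\<exists>y\<in>Z. \<forall>w\<in>dom p. p w = Some (y w))}"

text \<open>Given injective numberings \<open>c\<close> of the generators and \<open>d\<close> of the alphabet, a pattern is coded
  by the code of its graph, a finite set of natural numbers.\<close>

definition letter_code :: "('g \<Rightarrow> nat) \<Rightarrow> 'g \<times> bool \<Rightarrow> nat" where
  "letter_code c l = prod_encode (c (fst l), of_bool (snd l))"

definition word_code :: "('g \<Rightarrow> nat) \<Rightarrow> 'g word \<Rightarrow> nat" where
  "word_code c w = list_encode (map (letter_code c) w)"

definition pattern_code :: "('g \<Rightarrow> nat) \<Rightarrow> ('a \<Rightarrow> nat) \<Rightarrow> ('g word \<rightharpoonup> 'a) \<Rightarrow> nat" where
  "pattern_code c d p = set_encode {prod_encode (word_code c w, d a) | w a. p w = Some a}"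

text \<open>The numberings \<open>c\<close> and \<open>d\<close> of the finite sets \<open>S\<close> and \<open>A\<close> may be chosen arbitrarily: any two
  choices differ by a computable recoding of the patterns.\<close>

definition effective_subshift :: "('g, 'm) monoid_scheme \<Rightarrow> 'a set \<Rightarrow> ('g \<Rightarrow> 'a) set \<Rightarrow> bool" where
  "effective_subshift G A X \<longleftrightarrow> subshift G A X \<and>
     (\<exists>S. finite S \<and> S \<subseteq> carrier G \<and> generate G S = carrier G \<and>
       (\<exists>c d. inj_on c S \<and> inj_on d A \<and>
         recursively_enumerable
           (pattern_code c d ` forbidden_patterns (carrier (free_group S)) A (pullback G S X))))"


section \<open>Actions on zero-dimensional spaces and WEDS\<close>

text \<open>The empty space is allowed.\<close>

definition zero_dimensional_space :: "'a topology \<Rightarrow> bool" where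
  "zero_dimensional_space X \<longleftrightarrow> compact_space X \<and> metrizable_space X \<and> X dim_le 0"

definition topological_action ::
    "('g, 'm) monoid_scheme \<Rightarrow> 'a topology \<Rightarrow> ('g \<Rightarrow> 'a \<Rightarrow> 'a) \<Rightarrow> bool" where
  "topological_action G X \<alpha> \<longleftrightarrow> group_action G (topspace X) \<alpha> \<and>
     (\<forall>g\<in>carrier G. homeomorphic_map X X (\<alpha> g))"

definition topological_factor :: "('g, 'm) monoid_scheme \<Rightarrow>
    'a topology \<Rightarrow> ('g \<Rightarrow> 'a \<Rightarrow> 'a) \<Rightarrow> 'b topology \<Rightarrow> ('g \<Rightarrow> 'b \<Rightarrow> 'b) \<Rightarrow> bool" where
  "topological_factor G X \<alpha> Y \<beta> \<longleftrightarrow>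
     (\<exists>f. continuous_map X Y f \<and> f ` topspace X = topspace Y \<and>
       (\<forall>g\<in>carrier G. \<forall>x\<in>topspace X. f (\<alpha> g x) = \<beta> g (f x)))"

definition clopen_partition :: "'a topology \<Rightarrow> nat \<Rightarrow> (nat \<Rightarrow> 'a set) \<Rightarrow> bool" where
  "clopen_partition X n P \<longleftrightarrow> partition_on (topspace X) (P ` {1..n}) \<and> inj_on P {1..n} \<and>
     (\<forall>i\<in>{1..n}. openin X (P i) \<and> closedin X (P i))"

definition partition_subshift :: "('g, 'm) monoid_scheme \<Rightarrow> 'a topology \<Rightarrow> ('g \<Rightarrow> 'a \<Rightarrow> 'a) \<Rightarrow>
    nat \<Rightarrow> (nat \<Rightarrow> 'a set) \<Rightarrow> ('g \<Rightarrow> nat) set" where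
  "partition_subshift G X \<alpha> n P =
     {y \<in> carrier G \<rightarrow>\<^sub>E {1..n}. \<exists>x\<in>topspace X. \<forall>g\<in>carrier G. \<alpha> (inv\<^bsub>G\<^esub> g) x \<in> P (y g)}"

lemma subshift_partition_subshift:
  assumes "group G" "topological_action G X \<alpha>" "compact_space X" "clopen_partition X n P"
  shows "subshift G {1..n} (partition_subshift G X \<alpha> n P)"
proof -
  interpret group_action G "topspace X" \<alpha>
    using assms by (simp add: topological_action_def)
  interpret group G by fact
  have part: "partition_on (topspace X) (P ` {1..n})" and inj: "inj_on P {1..n}"
    and op: "\<And>i. i \<in> {1..n} \<Longrightarrow> openin X (P i)"
    using assms(4) by (auto simp: clopen_partition_def)
  have cover: "(\<Union>i\<in>{1..n}. P i) = topspace X"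
    using partition_onD1[OF part] by simp
  have disj: "i = j" if "i \<in> {1..n}" "j \<in> {1..n}" "x \<in> P i" "x \<in> P j" for i j x
  proof -
    have "P i = P j"
      using partition_onD2[OF part] that unfolding disjoint_def by blast
    then show ?thesis using inj that by (simp add: inj_on_eq_iff)
  qed
  have act: "\<alpha> g x \<in> topspace X" if "g \<in> carrier G" "x \<in> topspace X" for g x
    using element_image[OF that] by simp
  define idx where "idx x = (THE i. i \<in> {1..n} \<and> x \<in> P i)" for x
  have idx_eq: "idx x = i" if "i \<in> {1..n}" "x \<in> P i" for x i
    unfolding idx_def
  proof (rule the_equality)
    show "i \<in> {1..n} \<and> x \<in> P i" using that by (rule conjI)
    fix j assume "j \<in> {1..n} \<and> x \<in> P j"
    then show "j = i" using disj[OF _ that(1) _ that(2)] by (elim conjE)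
  qed
  have idx: "idx x \<in> {1..n}" "x \<in> P (idx x)" if "x \<in> topspace X" for x
  proof -
    have "x \<in> (\<Union>i\<in>{1..n}. P i)" using that by (simp only: cover)
    then obtain i where "i \<in> {1..n}" "x \<in> P i" by (rule UN_E)
    then show "idx x \<in> {1..n}" "x \<in> P (idx x)" by (simp_all only: idx_eq[of i x])
  qed
  define F where "F x = (\<lambda>g\<in>carrier G. idx (\<alpha> (inv\<^bsub>G\<^esub> g) x))" for x
  let ?T = "product_topology (\<lambda>_. discrete_topology {1..n}) (carrier G)"
  have cont_idx: "continuous_map X (discrete_topology {1..n}) idx"
    unfolding continuous_map_def
  proof (intro conjI allI impI)
    show "idx \<in> topspace X \<rightarrow> topspace (discrete_topology {1..n})" using idx(1) by simp
    fix U assume "openin (discrete_topology {1..n}) U"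
    then have U: "U \<subseteq> {1..n}" by (simp only: openin_discrete_topology)
    have "{x \<in> topspace X. idx x \<in> U} = (\<Union>i\<in>U. P i)"
    proof (intro equalityI subsetI)
      fix x assume "x \<in> (\<Union>i\<in>U. P i)"
      then obtain i where "i \<in> U" "x \<in> P i" by blast
      moreover then have "idx x = i" "x \<in> topspace X" using idx_eq[of i x] U cover by blast+
      ultimately show "x \<in> {x \<in> topspace X. idx x \<in> U}" by simp
    next
      fix x assume "x \<in> {x \<in> topspace X. idx x \<in> U}"
      then show "x \<in> (\<Union>i\<in>U. P i)" using idx(2)[of x] by blast
    qed
    moreover have "openin X (\<Union>i\<in>U. P i)"
      by (rule openin_Union) (use op U in \<open>blast\<close>)
    ultimately show "openin X {x \<in> topspace X. idx x \<in> U}" by (simp only:)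
  qed
  have "continuous_map X (discrete_topology {1..n}) (\<lambda>x. F x g)" if g: "g \<in> carrier G" for g
  proof -
    have "continuous_map X X (\<alpha> (inv\<^bsub>G\<^esub> g))"
      using g assms(2) by (simp add: topological_action_def homeomorphic_imp_continuous_map)
    then have "continuous_map X (discrete_topology {1..n}) (idx \<circ> \<alpha> (inv\<^bsub>G\<^esub> g))"
      using cont_idx by (rule continuous_map_compose)
    then show ?thesis using g by (simp add: F_def comp_def)
  qed
  then have "continuous_map X ?T F"
    unfolding continuous_map_componentwise by (simp add: F_def image_subset_iff)
  then have "compactin ?T (F ` topspace X)"
    using assms(3) unfolding compact_space_def by (metis image_compactin)
  then have closed: "closedin ?T (F ` topspace X)"
    by (intro compactin_imp_closedin) (auto simp: Hausdorff_space_product_topology)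
  have "partition_subshift G X \<alpha> n P = F ` topspace X"
  proof (intro equalityI subsetI)
    fix y assume "y \<in> partition_subshift G X \<alpha> n P"
    then obtain x where x: "x \<in> topspace X" "\<forall>g\<in>carrier G. \<alpha> (inv\<^bsub>G\<^esub> g) x \<in> P (y g)"
      and y: "y \<in> carrier G \<rightarrow>\<^sub>E {1..n}" by (auto simp: partition_subshift_def)
    have "y = F x"
    proof (rule extensionalityI[of _ "carrier G"])
      fix g assume g: "g \<in> carrier G"
      then have "y g \<in> {1..n}" using y by (rule PiE_mem[rotated])
      then have "idx (\<alpha> (inv\<^bsub>G\<^esub> g) x) = y g" using x(2) g idx_eq by blast
      then show "y g = F x g" using g by (simp add: F_def)
    qed (use y in \<open>auto simp: F_def PiE_def\<close>)
    then show "y \<in> F ` topspace X" using x by blast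
  next
    fix y assume "y \<in> F ` topspace X"
    then obtain x where x: "x \<in> topspace X" and y: "y = F x" by (rule imageE)
    have "F x \<in> carrier G \<rightarrow>\<^sub>E {1..n}"
      unfolding F_def using idx(1) act x by (intro restrict_PiE_iff[THEN iffD2] ballI) simp
    moreover have "\<forall>g\<in>carrier G. \<alpha> (inv\<^bsub>G\<^esub> g) x \<in> P (F x g)"
      using idx(2) act x by (simp add: F_def)
    ultimately show "y \<in> partition_subshift G X \<alpha> n P"
      unfolding partition_subshift_def y using x by blast
  qed
  moreover have "shift G g (F x) = F (\<alpha> g x)" if "g \<in> carrier G" "x \<in> topspace X" for g x
  proof
    fix h
    show "shift G g (F x) h = F (\<alpha> g x) h"
      using that composition_rule[of x "inv\<^bsub>G\<^esub> h" g] by (simp add: shift_def F_def inv_mult_group)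
  qed
  ultimately show ?thesis using closed act by (simp add: subshift_def)
qed

definition weak_effective_dynamical_system ::
    "('g, 'm) monoid_scheme \<Rightarrow> 'a topology \<Rightarrow> ('g \<Rightarrow> 'a \<Rightarrow> 'a) \<Rightarrow> bool" where
  "weak_effective_dynamical_system G X \<alpha> \<longleftrightarrow>
     zero_dimensional_space X \<and> topological_action G X \<alpha> \<and>
     (\<forall>n P. clopen_partition X n P \<longrightarrow>
       effective_subshift G {1..n} (partition_subshift G X \<alpha> n P))"

end

(* The preimages under the factor map of the pieces of a clopen partition of the factor form a clopen
   partition of the extension; by equivariance and surjectivity both partitions define the same
   subshift. *)

theory Submission
  imports Defs
begin

text \<open>Continuity makes the preimages clopen. Since \<open>clopen_partition\<close> demands
  nonempty pieces and an injective indexing, surjectivity of \<open>f\<close> matters: without it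
  preimages of distinct pieces could both be empty.\<close>

lemma clopen_partition_vimage:
  assumes P: "clopen_partition Y n P"
    and f: "continuous_map X Y f" "f ` topspace X = topspace Y"
  shows "clopen_partition X n (\<lambda>i. {x \<in> topspace X. f x \<in> P i})"
proof -
  let ?Q = "\<lambda>i. {x \<in> topspace X. f x \<in> P i}"
  have part: "partition_on (topspace Y) (P ` {1..n})" and inj: "inj_on P {1..n}"
    and clopen: "\<And>i. i \<in> {1..n} \<Longrightarrow> openin Y (P i) \<and> closedin Y (P i)"
    using P by (auto simp: clopen_partition_def)
  have cover: "(\<Union>i\<in>{1..n}. P i) = topspace Y"
    using partition_onD1[OF part] by simp
  \<comment> \<open>By surjectivity each piece is recovered from its preimage. This yields both
    injectivity of \<open>?Q\<close> and, below, nonemptiness of its values.\<close>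
  have image: "f ` ?Q i = P i" if "i \<in> {1..n}" for i
  proof -
    have "P i \<subseteq> f ` topspace X"
      using that cover f(2) by blast
    then show ?thesis by blast
  qed
  have inj_Q: "inj_on ?Q {1..n}"
  proof (rule inj_onI)
    fix i j assume i: "i \<in> {1..n}" and j: "j \<in> {1..n}" and "?Q i = ?Q j"
    then have "f ` ?Q i = f ` ?Q j" by blast
    then have "P i = P j" unfolding image[OF i] image[OF j] .
    then show "i = j" by (rule inj_onD[OF inj _ i j])
  qed
  have "partition_on (topspace X) (?Q ` {1..n})"
  proof (rule partition_onI)
    show "\<Union> (?Q ` {1..n}) = topspace X"
      using cover f(2) by blast
  next
    fix A B assume "A \<in> ?Q ` {1..n}" "B \<in> ?Q ` {1..n}" and AB: "A \<noteq> B"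
    then obtain i j where i: "i \<in> {1..n}" "A = ?Q i" and j: "j \<in> {1..n}" "B = ?Q j"
      by (elim imageE)
    \<comment> \<open>Different preimages come from different pieces, so disjointness is inherited
      from the partition of \<open>Y\<close>.\<close>
    then have "P i \<noteq> P j" using AB by auto
    then have "P i \<inter> P j = {}"
      using partition_onD2[OF part] i(1) j(1) unfolding disjoint_def by blast
    then show "disjnt A B" unfolding disjnt_def i(2) j(2) by blast
  next
    show "{} \<notin> ?Q ` {1..n}"
    proof
      assume "{} \<in> ?Q ` {1..n}"
      then obtain i where i: "i \<in> {1..n}" "{} = ?Q i"
        by (rule imageE)
      have "P i \<noteq> {}"
        using partition_onD3[OF part] i(1) by (metis imageI)
      then show False
        using image[OF i(1)] unfolding i(2)[symmetric] by blast
    qed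
  qed
  moreover have "openin X (?Q i) \<and> closedin X (?Q i)" if "i \<in> {1..n}" for i
    using clopen[OF that] f(1)
    by (blast intro: openin_continuous_map_preimage closedin_continuous_map_preimage)
  ultimately show ?thesis
    unfolding clopen_partition_def using inj_Q by (intro conjI ballI) simp_all
qed

text \<open>By equivariance the orbit of x visits the preimages exactly as the orbit of
  \<open>f x\<close> visits the sets \<open>P i\<close>, so x and \<open>f x\<close> witness the
  same configurations.\<close>

lemma partition_subshift_vimage:
  assumes "group G" "topological_action G X \<alpha>"
    and surj: "f ` topspace X = topspace Y"
    and equivariant: "\<And>g x. g \<in> carrier G \<Longrightarrow> x \<in> topspace X \<Longrightarrow> f (\<alpha> g x) = \<beta> g (f x)"
  shows "partition_subshift G X \<alpha> n (\<lambda>i. {x \<in> topspace X. f x \<in> P i}) =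
    partition_subshift G Y \<beta> n P"
proof -
  interpret group_action G "topspace X" \<alpha>
    using assms by (simp add: topological_action_def)
  interpret group G by fact
  \<comment> \<open>The first fact settles the condition of lying in \<open>topspace X\<close> that
    is built into the preimages; the second carries membership in \<open>P i\<close> between the two
    orbits.\<close>
  have "\<alpha> (inv\<^bsub>G\<^esub> g) x \<in> topspace X" "f (\<alpha> (inv\<^bsub>G\<^esub> g) x) = \<beta> (inv\<^bsub>G\<^esub> g) (f x)"
    if "g \<in> carrier G" "x \<in> topspace X" for g x
    using that element_image[of "inv\<^bsub>G\<^esub> g" x] equivariant by auto
  \<comment> \<open>Writing \<open>topspace Y\<close> as the image of \<open>topspace X\<close> lets
    the witness in \<open>Y\<close> range over the points \<open>f x\<close>.\<close>
  then show ?thesis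
    unfolding partition_subshift_def surj[symmetric] by auto
qed

theorem proposition8p7:
  fixes G :: "('g, 'm) monoid_scheme"
    and X :: "'a topology" and \<alpha> :: "'g \<Rightarrow> 'a \<Rightarrow> 'a"
    and Y :: "'b topology" and \<beta> :: "'g \<Rightarrow> 'b \<Rightarrow> 'b"
  assumes "group G" and "finitely_generated G"
    and "weak_effective_dynamical_system G X \<alpha>"
    and "zero_dimensional_space Y" and "topological_action G Y \<beta>"
    and "topological_factor G X \<alpha> Y \<beta>"
  shows "weak_effective_dynamical_system G Y \<beta>"
proof -
  obtain f where f: "continuous_map X Y f" "f ` topspace X = topspace Y"
    and equivariant: "\<And>g x. g \<in> carrier G \<Longrightarrow> x \<in> topspace X \<Longrightarrow> f (\<alpha> g x) = \<beta> g (f x)"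
    using assms(6) by (auto simp: topological_factor_def)
  have X: "topological_action G X \<alpha>"
    "\<And>n P. clopen_partition X n P \<Longrightarrow> effective_subshift G {1..n} (partition_subshift G X \<alpha> n P)"
    using assms(3) by (auto simp: weak_effective_dynamical_system_def)
  have "effective_subshift G {1..n} (partition_subshift G Y \<beta> n P)" if P: "clopen_partition Y n P" for n P
  proof -
    have "partition_subshift G X \<alpha> n (\<lambda>i. {x \<in> topspace X. f x \<in> P i}) = partition_subshift G Y \<beta> n P"
      using assms(1) X(1) f(2) equivariant by (rule partition_subshift_vimage)
    \<comment> \<open>Both subshifts are the same set over the same alphabet \<open>{1..n}\<close>,
      so effectiveness transfers without any recoding of patterns.\<close>
    with X(2)[OF clopen_partition_vimage[OF P f]] show ?thesis
      by (simp only:)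
  qed
  then show ?thesis
    unfolding weak_effective_dynamical_system_def using assms(4,5) by blast
qed

end
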